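(* Let $f:\operatorname{dom}(f)\subseteq\mathbb{R}^n\to\mathbb{R}$ and $g:\operatorname{dom}(g)\subseteq\mathbb{R}^n\to\mathbb{R}$, and let $\mathcal{X}=\langle x^0,x^0+d^1,\ldots,x^0+d^m\rangle$ be an ordered set of $m+1$ distinct points such that $\mathcal{X}\cup\mathcal{X}^-$ is contained in $\operatorname{dom}(f)\cap\operatorname{dom}(g)$ and for which $g(x^0),g(x^0\pm d^1),\ldots,g(x^0\pm d^m)$ are all nonzero. Then $$\nabla^c\left(\frac{f}{g}\right)(\mathcal{X})=\frac{g(x^0)\nabla^c f(\mathcal{X})-f(x^0)\nabla^c g(\mathcal{X})}{g^2(x^0)}-E^c_{\frac fg}(\mathcal{X}),$$ where $E^c_{\frac fg}(\mathcal{X})=\tfrac12\Big(E^s_{\frac fg}(\mathcal{X})+E^s_{\frac fg}(\mathcal{X}^-)\Big)$ and, for $\mathcal{Z}\in\{\mathcal{X},\mathcal{X}^-\}$, $E^s_{\frac fg}(\mathcal{Z})=\dfrac{1}{g(x^0)}(S(\mathcal{Z})^\top)^\dagger\,\delta^s_{\frac fg|g}(\mathcal{Z})$.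
   Context: $A^\dagger$ denotes the Moore--Penrose pseudoinverse of a matrix $A$. For an ordered set $\mathcal{Z}=\langle z^0,z^0+e^1,\ldots,z^0+e^m\rangle$ in $\mathbb{R}^n$ put $S(\mathcal{Z})=[e^1\ \cdots\ e^m]\in\mathbb{R}^{n\times m}$ and $\mathcal{Z}^-=\langle z^0,z^0-e^1,\ldots,z^0-e^m\rangle$ (so $S(\mathcal{Z}^-)=-S(\mathcal{Z})$). The generalized centred simplex gradient of a real-valued function $h$ over $\mathcal{Z}$ is $\nabla^c h(\mathcal{Z})=(S(\mathcal{Z})^\top)^\dagger\delta^c_h(\mathcal{Z})$, where $\delta^c_h(\mathcal{Z})\in\mathbb{R}^m$ has $i$-th entry $\tfrac12\big(h(z^0+e^i)-h(z^0-e^i)\big)$. The product difference vector of functions $u,v$ is $\delta^s_{u|v}(\mathcal{Z})\in\mathbb{R}^m$ with $i$-th entry $\big(u(z^0+e^i)-u(z^0)\big)\big(v(z^0+e^i)-v(z^0)\big)$. *)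

theory Defs
  imports "HOL-Analysis.Analysis"
begin

(* The four Penrose equations characterizing the Moore-Penrose pseudoinverse. *)
definition is_pinv :: "real^'n^'m \<Rightarrow> real^'m^'n \<Rightarrow> bool" where
  "is_pinv A P \<longleftrightarrow>
     A ** P ** A = A \<and> P ** A ** P = P \<and>
     transpose (A ** P) = A ** P \<and> transpose (P ** A) = P ** A"

lemma is_pinv_unique:
  fixes A :: "real^'n^'m"
  assumes P: "is_pinv A P" and Q: "is_pinv A Q"
  shows "P = Q"
proof -
  have p: "A ** P ** A = A" "P ** A ** P = P"
      "transpose (A ** P) = A ** P" "transpose (P ** A) = P ** A"
    and q: "A ** Q ** A = A" "Q ** A ** Q = Q"
      "transpose (A ** Q) = A ** Q" "transpose (Q ** A) = Q ** A"
    using P Q by (simp_all add: is_pinv_def)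
  have "A ** P = transpose ((A ** Q) ** (A ** P))"
    using p(3) q(1) by (simp add: matrix_mul_assoc)
  also have "\<dots> = A ** P ** (A ** Q)"
    using p(3) q(3) by (simp add: matrix_transpose_mul)
  also have "\<dots> = A ** Q"
    using p(1) by (simp add: matrix_mul_assoc)
  finally have 1: "A ** P = A ** Q" .
  have "P ** A = transpose ((P ** A) ** (Q ** A))"
    using p(4) q(1) by (metis matrix_mul_assoc)
  also have "\<dots> = Q ** A ** (P ** A)"
    using p(4) q(4) by (simp add: matrix_transpose_mul)
  also have "\<dots> = Q ** A"
    using p(1) by (metis matrix_mul_assoc)
  finally have 2: "P ** A = Q ** A" .
  have "P = P ** (A ** P)" using p(2) by (simp add: matrix_mul_assoc)
  also have "\<dots> = P ** A ** Q" by (simp add: 1 matrix_mul_assoc)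
  also have "\<dots> = Q" by (simp add: 2 q(2))
  finally show ?thesis .
qed

lemma matrix_symmetricI:
  fixes M :: "real^'n^'n"
  assumes "\<And>u v. (M *v u) \<bullet> v = u \<bullet> (M *v v)"
  shows "transpose M = M"
proof -
  have "(transpose M *v u) \<bullet> v = (M *v u) \<bullet> v" for u v
    by (simp add: assms dot_lmul_matrix transpose_matrix_vector)
  then show ?thesis
    by (metis matrix_eq vector_eq_rdot)
qed

lemma is_pinv_exists:
  fixes A :: "real^'n^'m"
  shows "\<exists>P. is_pinv A P"
proof -
  define K where "K = {k. A *v k = 0}"
  define R where "R = range ((*v) A)"
  have K: "subspace K"
    unfolding K_def by (simp add: linear_subspace_kernel)
  have R: "subspace R"
    unfolding R_def by (simp add: linear_subspace_image)
  define G where "G y x \<longleftrightarrow> (\<forall>k\<in>K. x \<bullet> k = 0) \<and> (\<forall>w. (y - A *v x) \<bullet> (A *v w) = 0)" for y x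
  have uniq: "x = x'" if "G y x" "G y x'" for y x x'
  proof -
    have "(A *v (x - x')) \<bullet> (A *v w) = 0" for w
      using that unfolding G_def
      by (simp add: matrix_vector_mult_diff_distrib inner_diff_left)
    then have "x - x' \<in> K" unfolding K_def using inner_eq_zero_iff by blast
    then have "(x - x') \<bullet> (x - x') = 0"
      using that unfolding G_def by (simp add: inner_diff_left)
    then show ?thesis by simp
  qed
  have ex: "\<exists>x. G y x" for y
  proof -
    obtain p q where p: "p \<in> span R" and q: "\<And>w. w \<in> span R \<Longrightarrow> orthogonal q w" and y: "y = p + q"
      using orthogonal_subspace_decomp_exists[of R y] by metis
    have "p \<in> R" using p R by (simp add: span_eq_iff[THEN iffD2])
    then obtain w where w: "p = A *v w" unfolding R_def by auto
    obtain k x where k: "k \<in> span K" and x: "\<And>z. z \<in> span K \<Longrightarrow> orthogonal x z" and wk: "w = k + x"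
      using orthogonal_subspace_decomp_exists[of K w] by metis
    have "k \<in> K" using k K by (simp add: span_eq_iff[THEN iffD2])
    then have "p = A *v x" using w wk by (simp add: K_def matrix_vector_right_distrib)
    moreover have "q \<bullet> (A *v z) = 0" for z
      using q[of "A *v z"] by (simp add: R_def orthogonal_def span_base)
    ultimately have "G y x"
      using x y by (simp add: G_def orthogonal_def span_base)
    then show ?thesis ..
  qed
  define X where "X y = (THE x. G y x)" for y
  have GX: "G y (X y)" for y
    unfolding X_def by (rule theI') (use ex uniq in blast)
  have XI: "X y = x" if "G y x" for x y
    using uniq GX that by blast
  have "linear X"
  proof (rule linearI)
    show "X (a + b) = X a + X b" for a b
      using GX[of a] GX[of b]
      by (intro XI) (simp add: G_def inner_add_left inner_diff_left matrix_vector_right_distrib)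
    show "X (c *\<^sub>R b) = c *\<^sub>R X b" for c b
      using GX[of b]
      by (intro XI) (simp add: G_def inner_diff_left matrix_vector_mult_scaleR)
  qed
  then have P: "matrix X *v y = X y" for y
    by (simp add: matrix_works)
  have AXA: "A *v X (A *v v) = A *v v" for v
  proof -
    have "(A *v (v - X (A *v v))) \<bullet> (A *v w) = 0" for w
      using GX[of "A *v v"] by (simp add: G_def matrix_vector_mult_diff_distrib)
    then have "A *v (v - X (A *v v)) = 0" using inner_eq_zero_iff by blast
    then show ?thesis by (simp add: matrix_vector_mult_diff_distrib)
  qed
  have XAX: "X (A *v X y) = X y" for y
    using GX[of y] by (intro XI) (simp add: G_def)
  have 3: "(A *v X u) \<bullet> v = u \<bullet> (A *v X v)" for u v
  proof -
    have "(v - A *v X v) \<bullet> (A *v X u) = 0" "(u - A *v X u) \<bullet> (A *v X v) = 0"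
      using GX[of v] GX[of u] by (auto simp: G_def)
    then show ?thesis
      using inner_commute[of v "A *v X u"] inner_commute[of "A *v X u" "A *v X v"]
      unfolding inner_diff_left by linarith
  qed
  have 4: "X (A *v u) \<bullet> v = u \<bullet> X (A *v v)" for u v
  proof -
    have "u - X (A *v u) \<in> K" "v - X (A *v v) \<in> K"
      by (simp_all add: K_def AXA matrix_vector_mult_diff_distrib)
    then have "X (A *v v) \<bullet> (u - X (A *v u)) = 0" "X (A *v u) \<bullet> (v - X (A *v v)) = 0"
      using GX by (auto simp: G_def)
    then show ?thesis
      using inner_commute[of u "X (A *v v)"] inner_commute[of "X (A *v u)" "X (A *v v)"]
      unfolding inner_diff_right by linarith
  qed
  have "is_pinv A (matrix X)"
    unfolding is_pinv_def
    using AXA XAX 3 4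
    by (intro conjI matrix_symmetricI)
       (simp_all add: matrix_eq P flip: matrix_vector_mul_assoc)
  then show ?thesis ..
qed

definition pinv :: "real^'n^'m \<Rightarrow> real^'m^'n" where
  "pinv A = (THE P. is_pinv A P)"

lemma is_pinv_pinv: "is_pinv A (pinv A)"
  unfolding pinv_def by (rule theI') (use is_pinv_exists is_pinv_unique in blast)

(* The pair (z, e) stands for the ordered set of the points z, z + e i for i in the
   index type 'm, so that CARD('m) is the number m of directions. *)
type_synonym ('n, 'm) oset = "(real^'n) \<times> ('m \<Rightarrow> real^'n)"

definition points :: "('n::finite, 'm::finite) oset \<Rightarrow> (real^'n) set" where
  "points Z = insert (fst Z) (range (\<lambda>i. fst Z + snd Z i))"

definition distinct_points :: "('n::finite, 'm::finite) oset \<Rightarrow> bool" where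
  "distinct_points Z \<longleftrightarrow>
     inj (\<lambda>i. fst Z + snd Z i) \<and> (\<forall>i. fst Z + snd Z i \<noteq> fst Z)"

definition reflect :: "('n::finite, 'm::finite) oset \<Rightarrow> ('n, 'm) oset" where
  "reflect Z = (fst Z, \<lambda>i. - snd Z i)"

definition S :: "('n::finite, 'm::finite) oset \<Rightarrow> real^'m^'n" where
  "S Z = (\<chi> k i. snd Z i $ k)"

definition delta_c :: "(real^'n \<Rightarrow> real) \<Rightarrow> ('n::finite, 'm::finite) oset \<Rightarrow> real^'m" where
  "delta_c h Z = (\<chi> i. 1/2 * (h (fst Z + snd Z i) - h (fst Z - snd Z i)))"

definition grad_c :: "(real^'n \<Rightarrow> real) \<Rightarrow> ('n::finite, 'm::finite) oset \<Rightarrow> real^'n" where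
  "grad_c h Z = pinv (transpose (S Z)) *v delta_c h Z"

definition delta_s ::
  "(real^'n \<Rightarrow> real) \<Rightarrow> (real^'n \<Rightarrow> real) \<Rightarrow> ('n::finite, 'm::finite) oset \<Rightarrow> real^'m" where
  "delta_s u v Z =
     (\<chi> i. (u (fst Z + snd Z i) - u (fst Z)) * (v (fst Z + snd Z i) - v (fst Z)))"

definition quot_err_s ::
  "(real^'n \<Rightarrow> real) \<Rightarrow> (real^'n \<Rightarrow> real) \<Rightarrow> ('n::finite, 'm::finite) oset \<Rightarrow> real^'n" where
  "quot_err_s f g Z =
     (1 / g (fst Z)) *\<^sub>R (pinv (transpose (S Z)) *v delta_s (\<lambda>x. f x / g x) g Z)"

definition quot_err_c ::
  "(real^'n \<Rightarrow> real) \<Rightarrow> (real^'n \<Rightarrow> real) \<Rightarrow> ('n::finite, 'm::finite) oset \<Rightarrow> real^'n" where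
  "quot_err_c f g Z = (1/2) *\<^sub>R (quot_err_s f g Z + quot_err_s f g (reflect Z))"

end

theory Submission
  imports Defs
begin

text \<open>
  The quotient rule for simplex gradients is an identity between vectors of differences to
  which one fixed linear map, the pseudoinverse of the transposed direction matrix, is applied.
  Along a single displacement from \<open>x0\<close> to \<open>y\<close>, the change of \<open>f / g\<close> equals the linear
  expression that the quotient rule predicts minus the product of the changes of \<open>f / g\<close> and of
  \<open>g\<close>, divided by \<open>g x0\<close> (\<open>quotient_difference\<close>). Half the difference of this identity for
  \<open>y = x0 + d i\<close> and \<open>y = x0 - d i\<close> is the entry \<open>i\<close> of the quotient rule for centred
  differences (\<open>delta_c_quotient\<close>), whose error term has a minus sign between the
  contributions of the set and of its reflection.

  The plus sign in the definition of the centred error is consistent with this because the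
  direction matrix of the reflected set is the negative of the original one, and the
  pseudoinverse is odd (\<open>pinv_uminus\<close>). Hence everything can be written with the single
  pseudoinverse of the original set, and linearity finishes the proof.
\<close>

lemma matrix_mult_uminus_left: "(- A) ** B = - (A ** B)" for A :: "real^'n^'m"
  by (simp add: matrix_matrix_mult_def vec_eq_iff sum_negf)

lemma matrix_mult_uminus_right: "A ** (- B) = - (A ** B)" for A :: "real^'n^'m"
  by (simp add: matrix_matrix_mult_def vec_eq_iff sum_negf)

lemma matrix_vector_mult_uminus_left: "(- A) *v x = - (A *v x)" for A :: "real^'n^'m"
  by (simp add: matrix_vector_mult_def vec_eq_iff sum_negf)

lemma transpose_uminus: "transpose (- A) = - transpose A" for A :: "real^'n^'m"
  by (simp add: transpose_def vec_eq_iff)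

lemma pinv_eqI: "is_pinv A P \<Longrightarrow> pinv A = P"
  using is_pinv_pinv is_pinv_unique by blast

text \<open>
  Every product in the Penrose equations for \<open>- A\<close> and \<open>- pinv A\<close> has either an even number of
  factors, so that the signs cancel, or three, so that both sides change sign.
\<close>

lemma pinv_uminus: "pinv (- A) = - pinv A"
proof (rule pinv_eqI)
  show "is_pinv (- A) (- pinv A)"
    using is_pinv_pinv[of A]
    by (simp add: is_pinv_def matrix_mult_uminus_left matrix_mult_uminus_right)
qed

lemma S_reflect: "S (reflect Z) = - S Z"
  by (simp add: S_def reflect_def vec_eq_iff)

lemma pinv_transpose_S_reflect:
  "pinv (transpose (S (reflect Z))) = - pinv (transpose (S Z))"
  by (simp add: S_reflect transpose_uminus pinv_uminus)

text \<open>
  Expanding the product on the right produces \<open>f y / g y * g y = f y\<close>; this cancellation, which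
  requires \<open>g y \<noteq> 0\<close>, is what makes the identity exact rather than an approximation.
\<close>

lemma quotient_difference:
  fixes f g :: "'a \<Rightarrow> real"
  assumes "g x \<noteq> 0" and "g y \<noteq> 0"
  shows "f y / g y - f x / g x =
    (g x * (f y - f x) - f x * (g y - g x)) / (g x)\<^sup>2
      - (f y / g y - f x / g x) * (g y - g x) / g x"
  using assms by (simp add: field_simps power2_eq_square)

lemma delta_c_quotient:
  fixes Z :: "('n::finite, 'm::finite) oset"
  assumes g0: "g (fst Z) \<noteq> 0"
    and g_plus: "\<And>i. g (fst Z + snd Z i) \<noteq> 0"
    and g_minus: "\<And>i. g (fst Z - snd Z i) \<noteq> 0"
  shows "delta_c (\<lambda>x. f x / g x) Z =
    (1 / (g (fst Z))\<^sup>2) *\<^sub>R (g (fst Z) *\<^sub>R delta_c f Z - f (fst Z) *\<^sub>R delta_c g Z)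
      - (1 / (2 * g (fst Z))) *\<^sub>R
          (delta_s (\<lambda>x. f x / g x) g Z - delta_s (\<lambda>x. f x / g x) g (reflect Z))"
    (is "?lhs = ?rhs")
proof -
  have "?lhs $ i = ?rhs $ i" for i
  proof -
    let ?p = "fst Z + snd Z i" and ?m = "fst Z - snd Z i"
    note plus = quotient_difference[of g "fst Z" ?p f, OF g0 g_plus]
    note minus = quotient_difference[of g "fst Z" ?m f, OF g0 g_minus]
    have "?lhs $ i =
      1/2 * ((f ?p / g ?p - f (fst Z) / g (fst Z)) - (f ?m / g ?m - f (fst Z) / g (fst Z)))"
      by (simp add: delta_c_def)
    also have "\<dots> = 1/2 *
      (((g (fst Z) * (f ?p - f (fst Z)) - f (fst Z) * (g ?p - g (fst Z))) / (g (fst Z))\<^sup>2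
          - (f ?p / g ?p - f (fst Z) / g (fst Z)) * (g ?p - g (fst Z)) / g (fst Z))
       - ((g (fst Z) * (f ?m - f (fst Z)) - f (fst Z) * (g ?m - g (fst Z))) / (g (fst Z))\<^sup>2
          - (f ?m / g ?m - f (fst Z) / g (fst Z)) * (g ?m - g (fst Z)) / g (fst Z)))"
      using plus minus by argo
    also have "\<dots> = ?rhs $ i"
    proof -
      \<comment> \<open>The two quotients stay opaque, so that only \<open>g (fst Z)\<close> occurs as a denominator.\<close>
      have "1/2 * (((b * (fp - a) - a * (gp - b)) / b\<^sup>2 - u * (gp - b) / b)
              - ((b * (fm - a) - a * (gm - b)) / b\<^sup>2 - v * (gm - b) / b))
          = 1 / b\<^sup>2 * (b * (1/2 * (fp - fm)) - a * (1/2 * (gp - gm)))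
              - 1 / (2 * b) * (u * (gp - b) - v * (gm - b))"
        if "b \<noteq> 0" for a b fp fm gp gm u v :: real
        using that by (simp add: field_simps power2_eq_square)
      from this[OF g0] show ?thesis
        by (simp add: delta_c_def delta_s_def reflect_def)
    qed
    finally show ?thesis .
  qed
  then show ?thesis
    by (simp add: vec_eq_iff)
qed

text \<open>
  The sum of the two one-sided errors is a difference once both are expressed through the
  pseudoinverse belonging to \<open>Z\<close>.
\<close>

lemma quot_err_c_eq:
  "quot_err_c f g Z = (1 / (2 * g (fst Z))) *\<^sub>R
    (pinv (transpose (S Z)) *v
      (delta_s (\<lambda>x. f x / g x) g Z - delta_s (\<lambda>x. f x / g x) g (reflect Z)))"
proof -
  have "fst (reflect Z) = fst Z"
    by (simp add: reflect_def)
  then show ?thesis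
    unfolding quot_err_c_def quot_err_s_def pinv_transpose_S_reflect
    by (simp add: matrix_vector_mult_uminus_left matrix_vector_mult_diff_distrib
        scaleR_diff_right)
qed

theorem proposition4p5:
  fixes f g :: "real^'n \<Rightarrow> real"
    and domf domg :: "(real^'n) set"
    and x0 :: "real^'n"
    and d :: "'m::finite \<Rightarrow> real^'n"
    and X :: "('n, 'm) oset"
  assumes X: "X = (x0, d)"
    and distinct: "distinct_points X"
    and dom: "points X \<union> points (reflect X) \<subseteq> domf \<inter> domg"
    and g0: "g x0 \<noteq> 0"
    and g_plus: "\<And>i. g (x0 + d i) \<noteq> 0"
    and g_minus: "\<And>i. g (x0 - d i) \<noteq> 0"
  shows "grad_c (\<lambda>x. f x / g x) X =
    (1 / (g x0)\<^sup>2) *\<^sub>R (g x0 *\<^sub>R grad_c f X - f x0 *\<^sub>R grad_c g X) - quot_err_c f g X"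
proof -
  have "delta_c (\<lambda>x. f x / g x) X =
    (1 / (g x0)\<^sup>2) *\<^sub>R (g x0 *\<^sub>R delta_c f X - f x0 *\<^sub>R delta_c g X)
      - (1 / (2 * g x0)) *\<^sub>R
          (delta_s (\<lambda>x. f x / g x) g X - delta_s (\<lambda>x. f x / g x) g (reflect X))"
    using delta_c_quotient[of g X f] g0 g_plus g_minus by (simp add: X)
  then show ?thesis
    unfolding grad_c_def quot_err_c_eq
    by (simp add: X matrix_vector_mult_diff_distrib matrix_vector_mult_scaleR)
qed

end
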